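(* Let $Y\subset\mathbb{R}^d$ be a finite set, $f:Y\to\{1,-1\}$, $t$ a nonnegative integer and $w>0$. Then $w^*(f,t)\ge w$ if and only if there exists a probability distribution $\mu:Y\to[0,1]$ such that (1) $\sum_{y\in Y}\mu(y)f(y)=0$, and (2) $\left|\sum_{y\in Y}\mu(y)f(y)\chi_S(y)\right|\le\frac1w$ for every $S\subseteq[d]$ with $|S|\le t$.
   Context: $\chi_S(y)=\prod_{i\in S}y_i$. For a real polynomial $p(y)=\sum_{S\subseteq[d]}c_S\chi_S(y)$, its degree is $\max\{|S|:c_S\ne0\}$ and its non-constant weight is $w^*(p)=\sum_{S\ne\emptyset}|c_S|$. The degree-$t$ non-constant margin weight of $f$ is $w^*(f,t)=\min\{w^*(p):\deg(p)\le t,\ f(y)p(y)\ge1\ \forall y\in Y\}$ (taken to be $+\infty$ if no such $p$ exists). *)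

theory Defs
  imports "HOL-Analysis.Analysis"
begin

definition chi :: "'d::finite set \<Rightarrow> real ^ 'd \<Rightarrow> real" where
  "chi S y = (\<Prod>i\<in>S. y $ i)"

text \<open>A polynomial \<open>p = \<Sum>S. c S * chi S\<close> is represented by its coefficient family \<open>c\<close>,
  indexed by the subsets of the coordinate set.\<close>

type_synonym 'd mpoly = "'d set \<Rightarrow> real"

definition mpoly_eval :: "'d::finite mpoly \<Rightarrow> real ^ 'd \<Rightarrow> real" where
  "mpoly_eval c y = (\<Sum>S\<in>UNIV. c S * chi S y)"

text \<open>The inserted \<open>0\<close> only matters for the zero polynomial, which gets degree \<open>0\<close>.\<close>

definition mpoly_deg :: "'d::finite mpoly \<Rightarrow> nat" where
  "mpoly_deg c = Max (insert 0 {card S | S. c S \<noteq> 0})"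

definition nonconst_weight :: "'d::finite mpoly \<Rightarrow> real" where
  "nonconst_weight c = (\<Sum>S\<in>{S. S \<noteq> {}}. \<bar>c S\<bar>)"

text \<open>The infimum in the extended reals is \<open>\<infinity>\<close> if no polynomial is feasible; for finite \<open>Y\<close> and a
  nonempty feasible set it is a minimum, being the optimal value of a linear program bounded
  below by \<open>0\<close>.\<close>

definition nonconst_margin_weight ::
    "(real ^ 'd::finite) set \<Rightarrow> (real ^ 'd \<Rightarrow> real) \<Rightarrow> nat \<Rightarrow> ereal" where
  "nonconst_margin_weight Y f t =
     Inf {ereal (nonconst_weight p) | p.
            mpoly_deg p \<le> t \<and> (\<forall>y\<in>Y. f y * mpoly_eval p y \<ge> 1)}"

definition prob_dist_on :: "'a set \<Rightarrow> ('a \<Rightarrow> real) \<Rightarrow> bool" where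
  "prob_dist_on Y \<mu> \<longleftrightarrow> (\<forall>y\<in>Y. \<mu> y \<in> {0..1}) \<and> (\<Sum>y\<in>Y. \<mu> y) = 1"

end

theory Submission
  imports Defs
begin

text \<open>
  Linear programming duality via separation. For \<open>card S \<le> t\<close> let \<open>v y\<close> have entries
  \<open>f y * chi S y\<close>. A distribution \<open>\<mu>\<close> as required exists iff the convex hull of the \<open>v y\<close> meets the
  box \<open>B\<close> of vectors with entry \<open>0\<close> at \<open>{}\<close> and all entries of absolute value at most \<open>1 / w\<close>.
  If they are disjoint, a hyperplane separates them strictly; since \<open>0 \<in> B\<close>, its normal vector can
  be scaled to the coefficients of a polynomial that has margin at least \<open>1\<close> on \<open>Y\<close>, and the
  support function of \<open>B\<close> shows that its weight is less than \<open>w\<close>.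
\<close>

lemma mem_convex_hull_image_finiteE:
  fixes v :: "'a \<Rightarrow> 'b::real_vector"
  assumes "finite Y" and "x \<in> convex hull (v ` Y)"
  obtains u where "\<And>y. y \<in> Y \<Longrightarrow> u y \<ge> 0" and "sum u Y = 1" and "(\<Sum>y\<in>Y. u y *\<^sub>R v y) = x"
proof -
  define C where "C = {\<Sum>y\<in>Y. u y *\<^sub>R v y | u. (\<forall>y\<in>Y. u y \<ge> (0::real)) \<and> sum u Y = 1}"
  have "v ` Y \<subseteq> C"
  proof
    fix z assume "z \<in> v ` Y"
    then obtain a where a: "a \<in> Y" "z = v a" by blast
    have "(\<Sum>y\<in>Y. (if y = a then 1 else 0) *\<^sub>R v y) = (\<Sum>y\<in>Y. if y = a then v y else 0)"
      by (rule sum.cong) auto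
    also have "\<dots> = z" using a \<open>finite Y\<close> by simp
    finally show "z \<in> C"
      unfolding C_def using a \<open>finite Y\<close>
      by (intro CollectI exI[of _ "\<lambda>y. if y = a then 1 else 0"]) auto
  qed
  moreover have "convex C"
  proof (rule convexI)
    fix p q :: 'b and s r :: real
    assume "p \<in> C" "q \<in> C" and sr: "0 \<le> s" "0 \<le> r" "s + r = 1"
    then obtain u u' where
      u: "p = (\<Sum>y\<in>Y. u y *\<^sub>R v y)" "\<forall>y\<in>Y. u y \<ge> 0" "sum u Y = 1" and
      u': "q = (\<Sum>y\<in>Y. u' y *\<^sub>R v y)" "\<forall>y\<in>Y. u' y \<ge> 0" "sum u' Y = 1"
      unfolding C_def by blast
    have "s *\<^sub>R p + r *\<^sub>R q = (\<Sum>y\<in>Y. (s * u y + r * u' y) *\<^sub>R v y)"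
      by (simp add: u(1) u'(1) scaleR_sum_right scaleR_add_left sum.distrib)
    moreover have "(\<Sum>y\<in>Y. s * u y + r * u' y) = 1"
      using u(3) u'(3) sr by (simp add: sum.distrib flip: sum_distrib_left)
    ultimately show "s *\<^sub>R p + r *\<^sub>R q \<in> C"
      unfolding C_def using u(2) u'(2) sr
      by (intro CollectI exI[of _ "\<lambda>y. s * u y + r * u' y"]) auto
  qed
  ultimately have "x \<in> C" using assms(2) hull_minimal by blast
  then show ?thesis unfolding C_def using that by blast
qed

lemma mpoly_deg_le_iff: "mpoly_deg c \<le> t \<longleftrightarrow> (\<forall>S. c S \<noteq> 0 \<longrightarrow> card S \<le> t)"
proof -
  have "finite {card S | S. c S \<noteq> 0}" by simp
  then show ?thesis unfolding mpoly_deg_def by auto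
qed

text \<open>Weak duality: averaging the margin inequality over \<open>\<mu>\<close> makes the
  constant coefficient vanish by balance, and every other coefficient contributes at most
  \<open>\<bar>c S\<bar> / w\<close>.\<close>

lemma nonconst_weight_ge:
  fixes c :: "'d::finite mpoly" and w :: real
  assumes w: "w > 0"
    and \<mu>: "prob_dist_on Y \<mu>" and bal: "(\<Sum>y\<in>Y. \<mu> y * f y) = 0"
    and corr: "\<And>S :: 'd set. card S \<le> t \<Longrightarrow> \<bar>\<Sum>y\<in>Y. \<mu> y * f y * chi S y\<bar> \<le> 1 / w"
    and deg: "mpoly_deg c \<le> t" and margin: "\<And>y. y \<in> Y \<Longrightarrow> f y * mpoly_eval c y \<ge> 1"
  shows "w \<le> nonconst_weight c"
proof -
  let ?m = "\<lambda>S. \<Sum>y\<in>Y. \<mu> y * f y * chi S y"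
  have "1 = (\<Sum>y\<in>Y. \<mu> y * 1)" using \<mu> by (simp add: prob_dist_on_def)
  also have "\<dots> \<le> (\<Sum>y\<in>Y. \<mu> y * (f y * mpoly_eval c y))"
    using \<mu> margin by (intro sum_mono mult_left_mono) (auto simp: prob_dist_on_def)
  also have "\<dots> = (\<Sum>y\<in>Y. \<Sum>S\<in>UNIV. c S * (\<mu> y * f y * chi S y))"
    by (simp add: mpoly_eval_def sum_distrib_left mult_ac)
  also have "\<dots> = (\<Sum>S\<in>UNIV. c S * ?m S)"
    by (subst sum.swap) (simp add: sum_distrib_left)
  also have "\<dots> = (\<Sum>S\<in>{S. S \<noteq> {}}. c S * ?m S)"
    using bal by (intro sum.mono_neutral_right) (auto simp: chi_def)
  also have "\<dots> \<le> (\<Sum>S\<in>{S. S \<noteq> {}}. \<bar>c S\<bar> * (1 / w))"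
  proof (rule sum_mono)
    fix S :: "'d set"
    show "c S * ?m S \<le> \<bar>c S\<bar> * (1 / w)"
    \<comment> \<open>The correlation bound is available only for \<open>card S \<le> t\<close>; the
      degree bound guarantees this whenever \<open>c S \<noteq> 0\<close>.\<close>
    proof (cases "c S = 0")
      case False
      then have "\<bar>?m S\<bar> \<le> 1 / w" using deg corr by (simp add: mpoly_deg_le_iff)
      then have "\<bar>c S\<bar> * \<bar>?m S\<bar> \<le> \<bar>c S\<bar> * (1 / w)" by (rule mult_left_mono) simp
      then show ?thesis using abs_ge_self[of "c S * ?m S"] by (simp add: abs_mult)
    qed simp
  qed
  also have "\<dots> = nonconst_weight c / w"
    by (simp add: nonconst_weight_def flip: sum_divide_distrib)
  finally show ?thesis using w by (simp add: field_simps)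
qed

lemma exists_distribution_or_light_polynomial:
  fixes Y :: "(real ^ 'd::finite) set" and w :: real
  assumes Y: "finite Y" and w: "w > 0"
  obtains (distribution) \<mu> where "prob_dist_on Y \<mu>" "(\<Sum>y\<in>Y. \<mu> y * f y) = 0"
      "\<And>S :: 'd set. card S \<le> t \<Longrightarrow> \<bar>\<Sum>y\<in>Y. \<mu> y * f y * chi S y\<bar> \<le> 1 / w"
  | (polynomial) c where "mpoly_deg c \<le> t" "\<And>y. y \<in> Y \<Longrightarrow> f y * mpoly_eval c y \<ge> 1"
      "nonconst_weight c < w"
proof -
  \<comment> \<open>The default \<open>0\<close> for large \<open>S\<close> places these entries
    inside the box, so they impose no constraint, and hides the matching entries of a normal vector
    from \<open>v y\<close>.\<close>
  define v :: "real ^ 'd \<Rightarrow> real ^ ('d set)"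
    where "v y = (\<chi> S. if card S \<le> t then f y * chi S y else 0)" for y
  \<comment> \<open>The box is flat at \<open>{}\<close>: since \<open>chi {} y = 1\<close>, the
    entry there is the balance sum, which must vanish exactly.\<close>
  define h :: "real ^ ('d set)" where "h = (\<chi> S. if S = {} then 0 else 1 / w)"
  have "convex hull (v ` Y) \<inter> cbox (- h) h \<noteq> {} \<or> convex hull (v ` Y) \<inter> cbox (- h) h = {}"
    by blast
  then show ?thesis
  proof
    assume "convex hull (v ` Y) \<inter> cbox (- h) h \<noteq> {}"
    then obtain x where x: "x \<in> convex hull (v ` Y)" "x \<in> cbox (- h) h" by blast
    obtain u where u: "\<And>y. y \<in> Y \<Longrightarrow> u y \<ge> 0" "sum u Y = 1" "(\<Sum>y\<in>Y. u y *\<^sub>R v y) = x"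
      using mem_convex_hull_image_finiteE[OF Y x(1)] by metis
    have bound: "\<bar>\<Sum>y\<in>Y. u y * f y * chi S y\<bar> \<le> h $ S" if "card S \<le> t" for S
    proof -
      have "(\<Sum>y\<in>Y. u y * f y * chi S y) = x $ S"
        using that by (simp add: v_def mult.assoc flip: u(3))
      moreover have "\<bar>x $ S\<bar> \<le> h $ S"
        using x(2) by (simp add: mem_box_cart abs_le_iff minus_le_iff)
      ultimately show ?thesis by simp
    qed
    show ?thesis
    proof (rule distribution)
      show "prob_dist_on Y u"
        unfolding prob_dist_on_def
      proof (intro conjI ballI)
        fix y assume "y \<in> Y"
        moreover from this have "u y \<le> sum u Y" using u(1) Y by (intro member_le_sum) auto
        ultimately show "u y \<in> {0..1}" using u(1,2) by simp
      qed (rule u(2))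
      show "(\<Sum>y\<in>Y. u y * f y) = 0"
        using bound[of "{}"] by (simp add: h_def chi_def)
      have "h $ S \<le> 1 / w" for S using w by (simp add: h_def)
      then show "\<bar>\<Sum>y\<in>Y. u y * f y * chi S y\<bar> \<le> 1 / w" if "card S \<le> t" for S
        using bound[OF that] order_trans by blast
    qed
  next
    assume disj: "convex hull (v ` Y) \<inter> cbox (- h) h = {}"
    have h_nonneg: "0 \<le> h $ S" for S using w by (simp add: h_def)
    have zero: "0 \<in> cbox (- h) h" using h_nonneg by (simp add: mem_box_cart)
    \<comment> \<open>The box serves as the nonempty compact side, so an empty \<open>Y\<close>,
      with empty hull, is covered too.\<close>
    have "\<exists>a b. (\<forall>x\<in>convex hull (v ` Y). a \<bullet> x < b) \<and> (\<forall>x\<in>cbox (- h) h. a \<bullet> x > b)"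
    proof (rule separating_hyperplane_closed_compact)
      show "closed (convex hull (v ` Y))"
        using Y by (intro compact_imp_closed compact_convex_hull finite_imp_compact finite_imageI)
      show "cbox (- h) h \<noteq> {}" using zero by blast
    qed (use disj in auto)
    then obtain a b where "\<forall>x\<in>convex hull (v ` Y). a \<bullet> x < b"
      and "\<forall>x\<in>cbox (- h) h. a \<bullet> x > b" by blast
    then have hull: "\<And>y. y \<in> Y \<Longrightarrow> a \<bullet> v y < b" and box: "\<And>x. x \<in> cbox (- h) h \<Longrightarrow> a \<bullet> x > b"
      by (auto simp: hull_inc)
    have b: "b < 0" using box[OF zero] by simp
    \<comment> \<open>Dividing by the negative \<open>b\<close> turns
      \<open>a \<bullet> v y < b\<close> into a margin above \<open>1\<close>. Truncation enforces
      the degree bound and leaves the margin unchanged, because \<open>v y\<close> is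
      \<open>0\<close> at the removed entries.\<close>
    define c where "c S = (if card S \<le> t then a $ S / b else 0)" for S
    show ?thesis
    proof (rule polynomial)
      show "mpoly_deg c \<le> t" by (auto simp: mpoly_deg_le_iff c_def)
      show "f y * mpoly_eval c y \<ge> 1" if "y \<in> Y" for y
      proof -
        have "f y * mpoly_eval c y = (a \<bullet> v y) / b"
          by (simp add: mpoly_eval_def c_def v_def inner_vec_def sum_distrib_left sum_divide_distrib)
             (rule sum.cong, auto)
        then show ?thesis using hull[OF that] b by (simp add: neg_le_divide_eq)
      qed
      \<comment> \<open>The vertex of the box at which \<open>a\<close> is minimal.\<close>
      define x where "x = (\<chi> S. - sgn (a $ S) * h $ S)"
      have "x \<in> cbox (- h) h"
        using h_nonneg by (auto simp: mem_box_cart x_def sgn_if)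
      then have "b < a \<bullet> x" by (rule box)
      also have "a \<bullet> x = - (\<Sum>S\<in>UNIV. \<bar>a $ S\<bar> * h $ S)"
        by (simp add: inner_vec_def x_def abs_sgn mult.assoc sum_negf)
      \<comment> \<open>As \<open>h\<close> vanishes at \<open>{}\<close>, the constant coefficient
        drops out; this is why exactly the non-constant weight gets bounded.\<close>
      also have "(\<Sum>S\<in>UNIV. \<bar>a $ S\<bar> * h $ S) = (\<Sum>S\<in>{S. S \<noteq> {}}. \<bar>a $ S\<bar> * h $ S)"
        by (rule sum.mono_neutral_right) (auto simp: h_def)
      also have "\<dots> = (\<Sum>S\<in>{S. S \<noteq> {}}. \<bar>a $ S\<bar>) / w"
        by (simp add: h_def sum_divide_distrib)
      finally have *: "(\<Sum>S\<in>{S. S \<noteq> {}}. \<bar>a $ S\<bar>) < w * - b"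
        using w by (simp add: field_simps)
      \<comment> \<open>Only an inequality, since truncation may discard nonzero entries of
        \<open>a\<close>.\<close>
      have "nonconst_weight c \<le> (\<Sum>S\<in>{S. S \<noteq> {}}. \<bar>a $ S\<bar> / \<bar>b\<bar>)"
        unfolding nonconst_weight_def by (intro sum_mono) (auto simp: c_def abs_divide)
      also have "\<dots> = (\<Sum>S\<in>{S. S \<noteq> {}}. \<bar>a $ S\<bar>) / - b"
        using b by (simp add: sum_negf sum_divide_distrib)
      also have "\<dots> < w" using * b by (subst pos_divide_less_eq) auto
      finally show "nonconst_weight c < w" .
    qed
  qed
qed

theorem theorem5p5:
  fixes Y :: "(real ^ 'd::finite) set"
    and f :: "real ^ 'd \<Rightarrow> real"
    and t :: nat
    and w :: real
  assumes "finite Y"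
    and "\<forall>y\<in>Y. f y \<in> {1, -1}"
    and "w > 0"
  shows "nonconst_margin_weight Y f t \<ge> ereal w \<longleftrightarrow>
    (\<exists>\<mu>. prob_dist_on Y \<mu> \<and>
      (\<Sum>y\<in>Y. \<mu> y * f y) = 0 \<and>
      (\<forall>S :: 'd set. card S \<le> t \<longrightarrow> \<bar>\<Sum>y\<in>Y. \<mu> y * f y * chi S y\<bar> \<le> 1 / w))"
    (is "?L \<longleftrightarrow> ?R")
proof -
  \<comment> \<open>A lower bound on the infimum is a bound on each feasible polynomial; with none
    feasible both sides hold, in line with the value \<open>\<infinity>\<close>.\<close>
  have L: "?L \<longleftrightarrow>
    (\<forall>c. mpoly_deg c \<le> t \<and> (\<forall>y\<in>Y. f y * mpoly_eval c y \<ge> 1) \<longrightarrow> w \<le> nonconst_weight c)"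
    unfolding nonconst_margin_weight_def le_Inf_iff by auto
  show ?thesis
  proof
    assume ?L
    show ?R
    proof (rule exists_distribution_or_light_polynomial[OF assms(1,3), where f = f and t = t])
      fix c assume "mpoly_deg c \<le> t" "\<And>y. y \<in> Y \<Longrightarrow> f y * mpoly_eval c y \<ge> 1"
        "nonconst_weight c < w"
      then show ?R using \<open>?L\<close> unfolding L by (meson not_le)
    qed blast
  next
    assume ?R
    then show ?L unfolding L using nonconst_weight_ge[OF assms(3)] by blast
  qed
qed

end
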